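(* Let $m\in\{2,3\}$, let $p^0\in\mathbb R^m$ be the source and let $p_1,p_2,\ldots\in\mathbb R^m$ be a sequence of sensor positions. Suppose: (a) The source $p^0$ lies within a bounded set $\mathcal P^0$, and the sensors $p_i$, $i=1,\dots,n$, belong to a bounded set $\mathcal P$, independent of $n$; moreover $\mathcal P^0\cap\mathcal P=\emptyset$. (b) The empirical distribution function $F_n$ of the sensor sequence $p_1,p_2,\ldots$ converges, as $n\to\infty$, to a distribution function $F_\mu$, and $\mu$ denotes the probability measure induced by $F_\mu$. (c) For every $n\ge m+1$, the sensors $p_1,\dots,p_n$ do not lie on a line (when $m=2$) or on a plane (when $m=3$). Moreover, there does not exist any subset $\mathcal P'$ of $\mathcal P$ with $\mu(\mathcal P')=1$ such that $\mathcal P'$ lies entirely on a line (for $m=2$) or on a plane (for $m=3$). Then the signal source $p^0$ is asymptotically localizable: with $$h_n(p)=\frac1n\sum_{i=1}^n\bigl(\log_{10}\|p_i-p\|-\log_{10}\|p_i-p^0\|\bigr)^2,$$ $h_n(p)$ has a limit function $h(p)=\lim_{n\to\infty}h_n(p)$, and $h(p)$ has a unique minimum at $p=p^0$.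
   Context: $\|\cdot\|$ is the Euclidean norm. The empirical distribution of $p_1,\dots,p_n$ is $\frac1n\sum_{i=1}^n\delta_{p_i}$, with $\delta_x$ the Dirac measure at $x$; convergence of distribution functions is in the usual sense (weak convergence). In the received-signal-strength localization model, measurements are $y_i=\log_{10}\|p_i-p^0\|+\omega_i$ with noises $\omega_i$, and $\log_{10}\|p_i-p\|$ is the predicted measurement for sensor $i$ when the source is at $p$. By definition, the source is asymptotically localizable if $h_n$ has a limit function $h$ and $h$ has a unique minimum at $p=p^0$.
   Formalization: The bounded set P is additionally assumed closed (the claim fails otherwise); the limit h(p) is asserted to exist for p outside P, and p^0 is the unique minimum of h over all non-sensor points where the limit exists. *)

theory Defs
  imports "HOL-Probability.Probability"
begin

text \<open>
  The order on \<^typ>\<open>real ^ 'm\<close> is componentwise, so \<^term>\<open>{..x}\<close> is the orthant below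
  \<^term>\<open>x\<close>. On the reals the library offers \<^const>\<open>cdf\<close> and \<^const>\<open>weak_conv\<close>; the next
  two definitions are their multivariate counterparts.
\<close>

definition joint_cdf :: "(real ^ 'm) measure \<Rightarrow> real ^ 'm \<Rightarrow> real" where
  "joint_cdf M x = measure M {..x}"

definition joint_weak_conv :: "(nat \<Rightarrow> real ^ 'm \<Rightarrow> real) \<Rightarrow> (real ^ 'm \<Rightarrow> real) \<Rightarrow> bool" where
  "joint_weak_conv F_seq F \<longleftrightarrow> (\<forall>x. isCont F x \<longrightarrow> (\<lambda>n. F_seq n x) \<longlonglongrightarrow> F x)"

text \<open>
  Sensors are numbered from 1; the value \<^term>\<open>p 0\<close> of a sensor sequence is never used.
  The Dirac measure at \<^term>\<open>a\<close> is \<^term>\<open>return borel a\<close>.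
\<close>

definition empirical_cdf :: "(nat \<Rightarrow> real ^ 'm) \<Rightarrow> nat \<Rightarrow> real ^ 'm \<Rightarrow> real" where
  "empirical_cdf p n x = (1 / real n) * (\<Sum>i=1..n. joint_cdf (return borel (p i)) x)"

text \<open>A line if the dimension is 2, a plane if it is 3.\<close>

definition on_hyperplane :: "(real ^ 'm) set \<Rightarrow> bool" where
  "on_hyperplane S \<longleftrightarrow> (\<exists>H. affine H \<and> aff_dim H = int CARD('m) - 1 \<and> S \<subseteq> H)"

definition rss_cost :: "(nat \<Rightarrow> real ^ 'm) \<Rightarrow> real ^ 'm \<Rightarrow> nat \<Rightarrow> real ^ 'm \<Rightarrow> real" where
  "rss_cost p p0 n q =
     (1 / real n) * (\<Sum>i=1..n. (log 10 (norm (p i - q)) - log 10 (norm (p i - p0)))\<^sup>2)"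

text \<open>
  The points at which the limit function is defined. Sensor positions are excluded because the
  predicted measurement is undefined there, whereas \<^term>\<open>log 10 0\<close> is 0 in HOL.
\<close>

definition limit_domain :: "(nat \<Rightarrow> real ^ 'm) \<Rightarrow> real ^ 'm \<Rightarrow> (real ^ 'm) set" where
  "limit_domain p p0 = {q. q \<notin> p ` {1..} \<and> convergent (\<lambda>n. rss_cost p p0 n q)}"

definition limit_cost :: "(nat \<Rightarrow> real ^ 'm) \<Rightarrow> real ^ 'm \<Rightarrow> real ^ 'm \<Rightarrow> real" where
  "limit_cost p p0 q = lim (\<lambda>n. rss_cost p p0 n q)"

text \<open>
  The limit function has to exist at least on \<^term>\<open>Q\<close>. The minimum is taken over every point
  at which it exists, inside \<^term>\<open>Q\<close> or not.
\<close>

definition asymptotically_localizable ::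
  "(real ^ 'm) set \<Rightarrow> (nat \<Rightarrow> real ^ 'm) \<Rightarrow> real ^ 'm \<Rightarrow> bool" where
  "asymptotically_localizable Q p p0 \<longleftrightarrow>
     Q \<subseteq> limit_domain p p0 \<and>
     (\<forall>q. is_arg_min (limit_cost p p0) (\<lambda>x. x \<in> limit_domain p p0) q \<longleftrightarrow> q = p0)"

end

theory Submission
  imports Defs
begin

text \<open>
  Weak convergence of the empirical measures gives \<open>h_n(q) \<longlonglongrightarrow> \<integral> (log\<^sub>1\<^sub>0 \<bar>x - q\<bar> - log\<^sub>1\<^sub>0 \<bar>x - p0\<bar>)\<^sup>2 d\<mu>\<close>
  for \<open>q\<close> outside the compact set \<open>P\<close>. Since \<open>\<bar>ln u - ln v\<bar> \<ge> \<bar>u - v\<bar> / R\<close> for \<open>u, v\<close> in \<open>(0, R]\<close>, for every \<open>q\<close>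
  that is not a sensor, even one in \<open>P\<close>, the limit, if it exists, is at least a positive multiple of
  \<open>\<integral> (\<bar>x - q\<bar> - \<bar>x - p0\<bar>)\<^sup>2 d\<mu>\<close>. This vanishes only if \<open>\<mu>\<close> is concentrated on the perpendicular
  bisector of \<open>q\<close> and \<open>p0\<close>, which is a hyperplane unless \<open>q = p0\<close>.
  Passing from distribution functions to integrals of continuous functions uses that, on \<open>P\<close>, these
  are uniform limits of combinations of indicators of orthants whose corner is a continuity point.
\<close>

section \<open>Step functions built from orthants\<close>

text \<open>This is a sufficient condition for \<open>joint_cdf M\<close> to be continuous at
  \<open>x\<close>. It constrains each coordinate separately, so mixing coordinates of regular
  points gives a regular point again; minima and box corners rely on this.\<close>

definition regular_point :: "(real ^ 'm) measure \<Rightarrow> real ^ 'm \<Rightarrow> bool" where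
  "regular_point M x \<longleftrightarrow> (\<forall>j. measure M {y. y $ j = x $ j} = 0)"

text \<open>The constructors are exactly the operations under which limits of averages and integrals
  pass by linearity. Products are derived below instead, since averages do not commute with
  them.\<close>

inductive step_fun :: "(real ^ 'm) measure \<Rightarrow> (real ^ 'm \<Rightarrow> real) \<Rightarrow> bool" for M where
  const: "step_fun M (\<lambda>_. c)"
| orthant: "regular_point M x \<Longrightarrow> step_fun M (indicator {..x})"
| add: "step_fun M f \<Longrightarrow> step_fun M g \<Longrightarrow> step_fun M (\<lambda>y. f y + g y)"
| scale: "step_fun M f \<Longrightarrow> step_fun M (\<lambda>y. c * f y)"

lemma regular_point_min:
  assumes "regular_point M x" "regular_point M y"
  shows "regular_point M (\<chi> j. min (x $ j) (y $ j))"
  using assms by (auto simp: regular_point_def min_def)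

lemma atMost_Int_atMost_vec:
  fixes x y :: "real ^ 'm"
  shows "{..x} \<inter> {..y} = {..(\<chi> j. min (x $ j) (y $ j))}"
  by (auto simp: less_eq_vec_def)

text \<open>Orthants are closed under intersection, with the coordinatewise minimum as corner, so a
  product of two orthant indicators is one orthant indicator. Linearity in \<open>g\<close> does the
  rest.\<close>

lemma step_fun_orthant_mult:
  assumes "step_fun M g" "regular_point M x"
  shows "step_fun M (\<lambda>y. indicator {..x} y * g y)"
  using assms(1)
proof induction
  case (const c)
  show ?case
    using step_fun.scale[OF step_fun.orthant[OF assms(2)], of c] by (simp add: mult.commute)
next
  case (orthant z)
  have "(\<lambda>y. indicator {..x} y * indicator {..z} y) =
      (indicator {..(\<chi> j. min (x $ j) (z $ j))} :: _ \<Rightarrow> real)"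
    by (simp add: fun_eq_iff flip: indicator_inter_arith atMost_Int_atMost_vec)
  then show ?case
    using step_fun.orthant[OF regular_point_min[OF assms(2) orthant]] by simp
next
  case (add f g)
  then show ?case using step_fun.add by (simp add: distrib_left)
next
  case (scale f c)
  then show ?case using step_fun.scale[of M _ c] by (simp add: mult.left_commute)
qed

lemma step_fun_mult:
  assumes "step_fun M f" "step_fun M g"
  shows "step_fun M (\<lambda>y. f y * g y)"
  using assms(1)
proof induction
  case (const c)
  then show ?case using assms(2) by (rule step_fun.scale)
next
  case (orthant x)
  then show ?case using assms(2) by (simp add: step_fun_orthant_mult)
next
  case (add f1 f2)
  then show ?case using step_fun.add by (simp add: distrib_right)
next
  case (scale f c)
  then show ?case using step_fun.scale[of M _ c] by (simp add: mult.assoc)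
qed

lemma step_fun_diff:
  assumes "step_fun M f" "step_fun M g"
  shows "step_fun M (\<lambda>y. f y - g y)"
  using step_fun.add[OF assms(1) step_fun.scale[OF assms(2), of "-1"]] by simp

lemma step_fun_prod:
  assumes "\<And>j. j \<in> J \<Longrightarrow> step_fun M (f j)"
  shows "step_fun M (\<lambda>y. \<Prod>j\<in>J. f j y)"
  using assms
  by (induction J rule: infinite_finite_induct) (auto intro: step_fun.const step_fun_mult)

text \<open>Open below and closed above, so that the indicator is exactly a polynomial in indicators
  of the closed orthants \<open>{..x}\<close>.\<close>

definition half_open_box :: "real ^ 'm \<Rightarrow> real ^ 'm \<Rightarrow> (real ^ 'm) set" where
  "half_open_box a b = {y. \<forall>j. a $ j < y $ j \<and> y $ j \<le> b $ j}"

lemma box_subset_half_open_box: "box a b \<subseteq> half_open_box a b"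
  by (auto simp: half_open_box_def mem_box_cart less_imp_le)

lemma half_open_box_subset_cbox: "half_open_box a b \<subseteq> cbox a b"
  by (auto simp: half_open_box_def mem_box_cart less_imp_le)

text \<open>Inclusion-exclusion in product form: start from the orthant below \<open>b\<close> and,
  for each coordinate \<open>j\<close>, remove the points whose \<open>j\<close>-th coordinate is at
  most that of \<open>a\<close>.\<close>

lemma step_fun_half_open_box:
  fixes a b :: "real ^ 'm"
  assumes a: "regular_point M a" and b: "regular_point M b"
  shows "step_fun M (indicator (half_open_box a b))"
proof -
  \<comment> \<open>The corner \<open>c j\<close> is \<open>b\<close> with only coordinate
    \<open>j\<close> replaced by that of \<open>a\<close>; below \<open>b\<close>, its orthant tests
    coordinate \<open>j\<close> alone.\<close>
  define c where "c j = (\<chi> k. if k = j then a $ j else b $ k)" for j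
  have c: "regular_point M (c j)" for j
    using a b by (auto simp: regular_point_def c_def)
  have "indicator (half_open_box a b) y =
      indicator {..b} y * (\<Prod>j\<in>UNIV. 1 - indicator {..c j} y :: real)" for y :: "real ^ 'm"
  proof (cases "y \<le> b")
    case True
    have c_iff: "y \<in> {..c j} \<longleftrightarrow> y $ j \<le> a $ j" for j
      using True by (auto simp: less_eq_vec_def c_def)
    show ?thesis
    proof (cases "\<forall>j. a $ j < y $ j")
      case inside: True
      then have "y \<notin> {..c j}" for j using c_iff by (simp add: not_le)
      moreover have "y \<in> {..b}" "y \<in> half_open_box a b"
        using True inside by (auto simp: half_open_box_def less_eq_vec_def)
      ultimately show ?thesis by (simp del: atMost_iff)
    next
      case False
      then obtain j where j: "y \<in> {..c j}" using c_iff by (auto simp: not_less)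
      then have "(\<Prod>j\<in>UNIV. 1 - indicator {..c j} y :: real) = 0"
        by (intro prod_zero bexI[of _ j]) (auto simp del: atMost_iff)
      moreover have "y \<notin> half_open_box a b" using False by (auto simp: half_open_box_def)
      ultimately show ?thesis by simp
    qed
  next
    case False
    then show ?thesis by (auto simp: half_open_box_def less_eq_vec_def indicator_def)
  qed
  moreover have "step_fun M (\<lambda>y. indicator {..b} y * (\<Prod>j\<in>UNIV. 1 - indicator {..c j} y))"
    by (intro step_fun_mult step_fun_prod step_fun_diff step_fun.const step_fun.orthant b c)
  ultimately show ?thesis by presburger
qed

lemma step_fun_bounded_measurable:
  assumes "step_fun M f" "sets M = sets borel"
  shows "f \<in> borel_measurable M \<and> (\<exists>B. \<forall>x. \<bar>f x\<bar> \<le> B)"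
  using assms(1)
proof induction
  case (const c)
  then show ?case by auto
next
  case (orthant x)
  have "{..x} \<in> sets M" by (simp add: assms(2) borel_closed closed_eucl_atMost)
  then show ?case by (auto simp: indicator_def intro!: exI[of _ 1])
next
  case (add f g)
  then obtain B C where "\<And>x. \<bar>f x\<bar> \<le> B" "\<And>x. \<bar>g x\<bar> \<le> C" by auto
  then have "\<bar>f x + g x\<bar> \<le> B + C" for x
    by (meson abs_triangle_ineq add_mono order_trans)
  then show ?case using add by auto
next
  case (scale f c)
  then obtain B where "\<And>x. \<bar>f x\<bar> \<le> B" by auto
  then have "\<bar>c * f x\<bar> \<le> \<bar>c\<bar> * B" for x
    by (simp add: abs_mult mult_left_mono)
  then show ?case using scale by auto
qed

locale borel_prob_space = prob_space M for M :: "(real ^ 'm) measure" +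
  assumes sets_M: "sets M = sets borel"
begin

lemma space_M: "space M = UNIV"
  using sets_eq_imp_space_eq[OF sets_M] by simp

end

lemma (in borel_prob_space) integrable_step_fun:
  assumes "step_fun M f"
  shows "integrable M f"
proof -
  obtain B where "f \<in> borel_measurable M" "\<And>x. \<bar>f x\<bar> \<le> B"
    using step_fun_bounded_measurable[OF assms sets_M] by auto
  then show ?thesis by (intro integrable_const_bound[where B = B]) auto
qed

section \<open>Regular points are dense continuity points\<close>

text \<open>The image of \<open>M\<close> under the \<open>j\<close>-th coordinate is a finite
  measure on the line, and such a measure has only countably many atoms.\<close>

lemma (in borel_prob_space) countable_marginal_atoms:
  shows "countable {t. measure M {y :: real ^ 'm. y $ j = t} \<noteq> 0}"
proof -
  have m: "(\<lambda>y. y $ j) \<in> measurable M borel"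
    using sets_M by (simp cong: measurable_cong_sets)
  interpret D: finite_measure "distr M borel (\<lambda>y. y $ j)"
    using m by (rule finite_measure_distr)
  have "measure (distr M borel (\<lambda>y. y $ j)) {t} = measure M {y. y $ j = t}" for t
    using m space_M by (simp add: measure_distr vimage_def)
  then show ?thesis using D.countable_support by simp
qed

lemma (in borel_prob_space) ex_regular_value:
  assumes "s < t"
  shows "\<exists>u. s < u \<and> u < t \<and> measure M {y :: real ^ 'm. y $ j = u} = 0"
proof (rule ccontr)
  assume "\<not> ?thesis"
  then have "{s<..<t} \<subseteq> {t. measure M {y. y $ j = t} \<noteq> 0}" by auto
  then have "countable {s<..<t}"
    using countable_marginal_atoms countable_subset by blast
  then show False using uncountable_open_interval assms by blast
qed

text \<open>Take any box around \<open>x\<close> inside \<open>U\<close> and move each face towards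
  \<open>x\<close> to a value without marginal mass; the coordinates can be chosen
  independently.\<close>

lemma (in borel_prob_space) ex_regular_box:
  fixes x :: "real ^ 'm"
  assumes "open U" "x \<in> U"
  shows "\<exists>a b. regular_point M a \<and> regular_point M b \<and> x \<in> box a b \<and> cbox a b \<subseteq> U"
proof -
  obtain a b where ab: "x \<in> box a b" "cbox a b \<subseteq> U"
    using open_contains_cbox assms by meson
  have "\<forall>j. \<exists>t. a $ j < t \<and> t < x $ j \<and> measure M {y. y $ j = t} = 0"
    using ab(1) by (intro allI ex_regular_value) (simp add: mem_box_cart)
  then obtain u where u: "\<And>j. a $ j < u j \<and> u j < x $ j \<and> measure M {y. y $ j = u j} = 0"
    unfolding choice_iff by blast
  have "\<forall>j. \<exists>t. x $ j < t \<and> t < b $ j \<and> measure M {y. y $ j = t} = 0"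
    using ab(1) by (intro allI ex_regular_value) (simp add: mem_box_cart)
  then obtain v where v: "\<And>j. x $ j < v j \<and> v j < b $ j \<and> measure M {y. y $ j = v j} = 0"
    unfolding choice_iff by blast
  have "cbox (\<chi> j. u j) (\<chi> j. v j) \<subseteq> cbox a b"
    using u v by (auto simp: mem_box_cart) (meson less_imp_le order_trans)+
  then show ?thesis using u v ab(2)
    by (intro exI[of _ "\<chi> j. u j"] exI[of _ "\<chi> j. v j"]) (auto simp: mem_box_cart regular_point_def)
qed

text \<open>Almost every \<open>z\<close> differs from \<open>x\<close> in every coordinate. For
  such \<open>z\<close> the indicators of \<open>{..X n}\<close> converge to that of
  \<open>{..x}\<close>, and dominated convergence applies.\<close>

lemma (in borel_prob_space) isCont_joint_cdf:
  fixes x :: "real ^ 'm"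
  assumes "regular_point M x"
  shows "isCont (joint_cdf M) x"
  unfolding continuous_at_sequentially
proof safe
  fix X assume X: "X \<longlonglongrightarrow> x"
  have S: "{..y} \<in> sets M" for y :: "real ^ 'm"
    by (simp add: sets_M borel_closed closed_eucl_atMost)
  have "AE z in M. \<forall>j. z $ j \<noteq> x $ j"
    unfolding AE_all_countable
  proof
    fix j
    have "{z. z $ j = x $ j} \<in> sets M"
      unfolding sets_M by (intro borel_closed closed_Collect_eq continuous_intros)
    moreover have "measure M {z. z $ j = x $ j} = 0"
      using assms by (simp add: regular_point_def)
    ultimately have "{z. z $ j = x $ j} \<in> null_sets M"
      by (simp add: null_sets_def emeasure_eq_measure)
    then show "AE z in M. z $ j \<noteq> x $ j" by (auto dest: AE_not_in)
  qed
  then have "AE z in M. (\<lambda>n. indicator {..X n} z :: real) \<longlonglongrightarrow> indicator {..x} z"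
  proof eventually_elim
    case (elim z)
    have Xj: "(\<lambda>n. X n $ j) \<longlonglongrightarrow> x $ j" for j by (intro tendsto_intros X)
    \<comment> \<open>Strict inequalities persist near the limit: all of the finitely many
      coordinates if \<open>z \<le> x\<close>, and a single violated one otherwise.\<close>
    have "\<forall>\<^sub>F n in sequentially. z \<le> X n \<longleftrightarrow> z \<le> x"
    proof (cases "z \<le> x")
      case True
      then have "z $ j < x $ j" for j using elim by (simp add: less_eq_vec_def order_less_le)
      then have "\<forall>\<^sub>F n in sequentially. \<forall>j. z $ j < X n $ j"
        by (intro eventually_all_finite order_tendstoD(1)[OF Xj])
      then show ?thesis
        by eventually_elim (use True in \<open>auto simp: less_eq_vec_def less_imp_le\<close>)
    next
      case False
      then obtain j where "x $ j < z $ j" by (auto simp: less_eq_vec_def not_le)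
      from order_tendstoD(2)[OF Xj this] show ?thesis
        by eventually_elim (use False in \<open>simp add: less_eq_vec_def, meson not_le\<close>)
    qed
    then have "\<forall>\<^sub>F n in sequentially. indicator {..X n} z = (indicator {..x} z :: real)"
      by eventually_elim (auto simp: indicator_def)
    then show ?case by (rule tendsto_eventually)
  qed
  then have "(\<lambda>n. \<integral>z. indicator {..X n} z \<partial>M) \<longlonglongrightarrow> (\<integral>z. indicator {..x} z \<partial>M :: real)"
    using S by (intro integral_dominated_convergence[where w = "\<lambda>_. 1"]) auto
  then show "(joint_cdf M \<circ> X) \<longlonglongrightarrow> joint_cdf M x"
    using S space_M by (simp add: o_def joint_cdf_def)
qed

section \<open>Convergence of averages\<close>

text \<open>The integral of \<open>f\<close> against the empirical measure of the first
  \<open>n\<close> sensors, a form shared by \<open>empirical_cdf\<close> and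
  \<open>rss_cost\<close>. It is 0 for \<open>n = 0\<close>.\<close>

definition average :: "(nat \<Rightarrow> 'a) \<Rightarrow> nat \<Rightarrow> ('a \<Rightarrow> real) \<Rightarrow> real" where
  "average p n f = (1 / real n) * (\<Sum>i=1..n. f (p i))"

lemma average_add: "average p n (\<lambda>x. f x + g x) = average p n f + average p n g"
  by (simp add: average_def sum.distrib distrib_left)

lemma average_scale: "average p n (\<lambda>x. c * f x) = c * average p n f"
  by (simp add: average_def flip: sum_distrib_left)

lemma average_const: "n > 0 \<Longrightarrow> average p n (\<lambda>_. c) = c"
  by (simp add: average_def)

lemma average_mono:
  assumes "\<And>i. i \<ge> 1 \<Longrightarrow> f (p i) \<le> g (p i)"
  shows "average p n f \<le> average p n g"
  unfolding average_def using assms by (intro mult_left_mono sum_mono) auto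

lemma average_dist:
  assumes "\<And>i. i \<ge> 1 \<Longrightarrow> \<bar>f (p i) - g (p i)\<bar> \<le> e" "e \<ge> 0"
  shows "\<bar>average p n f - average p n g\<bar> \<le> e"
proof (cases "n = 0")
  case False
  have "average p n f \<le> average p n (\<lambda>x. g x + e)" "average p n g \<le> average p n (\<lambda>x. f x + e)"
    using assms(1) by (auto intro!: average_mono simp: abs_le_iff algebra_simps)
  then show ?thesis using False by (simp add: average_add average_const)
qed (use assms(2) in \<open>simp add: average_def\<close>)

lemma empirical_cdf_eq_average: "empirical_cdf p n x = average p n (indicator {..x})"
  by (simp add: empirical_cdf_def average_def joint_cdf_def measure_return
      borel_closed closed_eucl_atMost)

text \<open>Both sides are linear in \<open>f\<close>, so the claim reduces to orthants, where it is
  the assumed convergence at a continuity point of the distribution function.\<close>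

lemma (in borel_prob_space) average_step_fun_tendsto:
  assumes conv: "joint_weak_conv (empirical_cdf p) (joint_cdf M)"
    and f: "step_fun M f"
  shows "(\<lambda>n. average p n f) \<longlonglongrightarrow> (\<integral>x. f x \<partial>M)"
  using f
proof induction
  case (const c)
  have "\<forall>\<^sub>F n in sequentially. average p n (\<lambda>_. c) = c"
    using eventually_gt_at_top[of 0] by eventually_elim (simp add: average_const)
  then show ?case by (simp add: tendsto_eventually prob_space)
next
  case (orthant x)
  have "(\<lambda>n. empirical_cdf p n x) \<longlonglongrightarrow> joint_cdf M x"
    using conv isCont_joint_cdf[OF orthant] by (simp add: joint_weak_conv_def)
  moreover have "{..x} \<in> sets M" by (simp add: sets_M borel_closed closed_eucl_atMost)
  ultimately show ?case
    using space_M by (simp add: empirical_cdf_eq_average joint_cdf_def)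
next
  case (add f g)
  then show ?case
    by (simp add: average_add integrable_step_fun tendsto_add)
next
  case (scale f c)
  then show ?case by (simp add: average_scale tendsto_mult_left)
qed

section \<open>Concentration of the limit measure on the sensor region\<close>

text \<open>A box with regular corners that avoids \<open>P\<close> contains no sensor, so its
  averages are 0 and its limit mass is 0. Countably many such boxes cover the complement of
  \<open>P\<close>.\<close>

lemma (in borel_prob_space) AE_in_closed_support:
  fixes P :: "(real ^ 'm) set"
  assumes conv: "joint_weak_conv (empirical_cdf p) (joint_cdf M)"
    and P: "closed P" "\<And>i. i \<ge> 1 \<Longrightarrow> p i \<in> P"
  shows "AE x in M. x \<in> P"
proof -
  \<comment> \<open>Three versions of each box are at work: the open one for the Lindelof covering,
    the half-open one as a step function, and the closed one, disjoint from \<open>P\<close>, which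
    contains both.\<close>
  define \<B> where "\<B> = {box a b | a b. regular_point M a \<and> regular_point M b \<and> cbox a b \<subseteq> - P}"
  have "\<Union>\<B> = - P"
    using ex_regular_box[of "- P"] P(1) box_subset_cbox unfolding \<B>_def by fastforce
  moreover obtain \<B>' where \<B>': "\<B>' \<subseteq> \<B>" "countable \<B>'" "\<Union>\<B>' = \<Union>\<B>"
    using Lindelof[of \<B>] by (auto simp: \<B>_def)
  moreover have "B \<in> null_sets M" if B: "B \<in> \<B>" for B
  proof -
    obtain a b where ab: "regular_point M a" "regular_point M b" "cbox a b \<subseteq> - P" "B = box a b"
      using B by (auto simp: \<B>_def)
    have "average p n (indicator (half_open_box a b)) = 0" for n
      using ab(3) P(2) half_open_box_subset_cbox[of a b]
      by (auto simp: average_def indicator_def intro!: sum.neutral)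
    then have "(\<integral>x. indicator (half_open_box a b) x \<partial>M) = (0 :: real)"
      using average_step_fun_tendsto[OF conv step_fun_half_open_box[OF ab(1,2)]]
      by (simp add: LIMSEQ_const_iff)
    moreover have S: "half_open_box a b \<in> sets M"
      using step_fun_bounded_measurable[OF step_fun_half_open_box[OF ab(1,2)] sets_M]
      by (simp add: borel_measurable_indicator_iff space_M)
    ultimately have "half_open_box a b \<in> null_sets M"
      by (simp add: null_sets_def emeasure_eq_measure space_M)
    then show ?thesis
      using box_subset_half_open_box ab(4) null_sets_subset sets_M by (metis borel_open open_box)
  qed
  ultimately have "(\<Union>B\<in>\<B>'. B) \<in> null_sets M" "(\<Union>B\<in>\<B>'. B) = - P"
    using null_sets_UN'[of \<B>' "\<lambda>B. B" M] by blast+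
  then have "- P \<in> null_sets M" by metis
  then show ?thesis by (auto dest: AE_not_in)
qed

section \<open>Passage from step functions to continuous functions\<close>

text \<open>By compactness, finitely many boxes with regular corners cover \<open>P\<close>, each
  with a marked point whose value under \<open>g\<close> is within \<open>e\<close> of
  \<open>g\<close> on the box. The approximant takes these values, box after box.\<close>

lemma (in borel_prob_space) step_fun_uniform_approx:
  fixes P :: "(real ^ 'm) set" and g :: "real ^ 'm \<Rightarrow> real"
  assumes P: "compact P" and g: "continuous_on P g" and e: "e > 0"
  obtains h where "step_fun M h" "\<And>x. x \<in> P \<Longrightarrow> \<bar>g x - h x\<bar> \<le> e"
proof -
  have "\<exists>a b. regular_point M a \<and> regular_point M b \<and> x \<in> box a b \<and>
      (\<forall>y \<in> P \<inter> cbox a b. \<bar>g y - g x\<bar> \<le> e)" if "x \<in> P" for x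
  proof -
    obtain d where d: "d > 0" "\<And>y. y \<in> P \<Longrightarrow> dist y x < d \<Longrightarrow> dist (g y) (g x) < e"
      using g e \<open>x \<in> P\<close> unfolding continuous_on_iff by metis
    obtain a b where ab: "regular_point M a" "regular_point M b" "x \<in> box a b" "cbox a b \<subseteq> ball x d"
      using ex_regular_box[of "ball x d" x] d(1) by auto
    have "\<bar>g y - g x\<bar> \<le> e" if "y \<in> P \<inter> cbox a b" for y
    proof -
      have "dist y x < d" using that ab(4) by (auto simp: dist_commute)
      then show ?thesis using d(2)[of y] that by (simp add: dist_real_def)
    qed
    then show ?thesis using ab(1-3) by blast
  qed
  then obtain a b where ab: "\<And>x. x \<in> P \<Longrightarrow> regular_point M (a x) \<and> regular_point M (b x) \<and>
      x \<in> box (a x) (b x) \<and> (\<forall>y \<in> P \<inter> cbox (a x) (b x). \<bar>g y - g x\<bar> \<le> e)"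
    by metis
  then have "P \<subseteq> (\<Union>x\<in>P. box (a x) (b x))" by blast
  then obtain C where C: "C \<subseteq> P" "finite C" "P \<subseteq> (\<Union>x\<in>C. box (a x) (b x))"
    using compactE_image[OF P, of P "\<lambda>x. box (a x) (b x)"] by (metis open_box)
  \<comment> \<open>The bound is claimed only on the boxes treated so far, which makes the induction
    over the finite cover start trivially.\<close>
  have "\<exists>h. step_fun M h \<and> (\<forall>y \<in> P \<inter> (\<Union>x\<in>C. half_open_box (a x) (b x)). \<bar>g y - h y\<bar> \<le> e)"
    using C(2,1)
  proof (induction C)
    case empty
    then show ?case by (auto intro: step_fun.const)
  next
    case (insert x C)
    then obtain h where h: "step_fun M h"
      "\<forall>y \<in> P \<inter> (\<Union>x\<in>C. half_open_box (a x) (b x)). \<bar>g y - h y\<bar> \<le> e" by auto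
    let ?i = "indicator (half_open_box (a x) (b x))"
    \<comment> \<open>The new box overwrites \<open>h\<close> by the constant \<open>g x\<close>, so
      overlaps with earlier boxes are harmless.\<close>
    have "step_fun M (\<lambda>y. g x * ?i y + (1 - ?i y) * h y)"
      using ab insert.prems h(1)
      by (intro step_fun.add step_fun.scale step_fun_mult step_fun_diff step_fun.const
          step_fun_half_open_box) auto
    moreover have "\<bar>g y - (g x * ?i y + (1 - ?i y) * h y)\<bar> \<le> e"
      if "y \<in> P \<inter> (\<Union>x\<in>insert x C. half_open_box (a x) (b x))" for y
      using that ab[of x] insert.prems h(2) half_open_box_subset_cbox[of "a x" "b x"]
      by (cases "y \<in> half_open_box (a x) (b x)") auto
    ultimately show ?case by blast
  qed
  then obtain h where h: "step_fun M h"
    "\<And>y. y \<in> P \<inter> (\<Union>x\<in>C. half_open_box (a x) (b x)) \<Longrightarrow> \<bar>g y - h y\<bar> \<le> e"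
    by blast
  have "\<bar>g y - h y\<bar> \<le> e" if y: "y \<in> P" for y
  proof -
    obtain x where "x \<in> C" "y \<in> box (a x) (b x)" using C(3) y by auto
    then have "x \<in> C" "y \<in> half_open_box (a x) (b x)"
      using box_subset_half_open_box[of "a x" "b x"] by auto
    then show ?thesis using h(2) y by auto
  qed
  then show ?thesis by (rule that[OF h(1)])
qed

text \<open>Since \<open>g\<close> is controlled only on \<open>P\<close>, the integral carries the
  indicator of \<open>P\<close>, which also makes the integrand Borel; the averages see only
  sensors, which lie in \<open>P\<close>.\<close>

lemma (in borel_prob_space) average_tendsto_integral:
  fixes P :: "(real ^ 'm) set" and g :: "real ^ 'm \<Rightarrow> real"
  assumes conv: "joint_weak_conv (empirical_cdf p) (joint_cdf M)"
    and P: "compact P" "\<And>i. i \<ge> 1 \<Longrightarrow> p i \<in> P"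
    and g: "continuous_on P g"
  shows "(\<lambda>n. average p n g) \<longlonglongrightarrow> (\<integral>x. indicator P x * g x \<partial>M)"
proof (rule LIMSEQ_I)
  fix r :: real assume r: "0 < r"
  have inP: "AE x in M. x \<in> P"
    using AE_in_closed_support[OF conv compact_imp_closed[OF P(1)] P(2)] .
  \<comment> \<open>Three errors below are each at most \<open>r / 4\<close>: in the integral, in
    the average, and between the average and integral of \<open>h\<close>. Their sum is below
    \<open>r\<close>.\<close>
  obtain h where h: "step_fun M h" "\<And>x. x \<in> P \<Longrightarrow> \<bar>g x - h x\<bar> \<le> r / 4"
    using step_fun_uniform_approx[OF P(1) g, of "r / 4"] r by auto
  let ?g = "\<lambda>x. indicator P x * g x"
  have int_h: "integrable M h" using integrable_step_fun[OF h(1)] .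
  have "?g \<in> borel_measurable borel"
    using borel_measurable_continuous_on_indicator[OF borel_closed[OF compact_imp_closed[OF P(1)]] g]
    by simp
  then have meas_g: "?g \<in> borel_measurable M"
    using sets_M by (simp cong: measurable_cong_sets)
  have close: "AE x in M. \<bar>?g x - h x\<bar> \<le> r / 4"
    using inP by eventually_elim (use h(2) in simp)
  \<comment> \<open>Integrability of \<open>?g\<close> is obtained by adding the integrable
    \<open>h\<close> to this almost surely bounded difference.\<close>
  have int_d: "integrable M (\<lambda>x. ?g x - h x)"
    using close by (intro integrable_const_bound[where B = "r / 4"])
      (auto intro: borel_measurable_diff meas_g borel_measurable_integrable[OF int_h])
  have int_g: "integrable M ?g"
    using Bochner_Integration.integrable_add[OF int_d int_h] by simp
  have "\<bar>\<integral>x. ?g x - h x \<partial>M\<bar> \<le> (\<integral>x. \<bar>?g x - h x\<bar> \<partial>M)"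
    by (rule integral_abs_bound)
  also have "\<dots> \<le> r / 4"
    using close int_d by (intro integral_le_const) auto
  finally have 1: "\<bar>(\<integral>x. ?g x \<partial>M) - (\<integral>x. h x \<partial>M)\<bar> \<le> r / 4"
    using int_g int_h by simp
  have 2: "\<bar>average p n g - average p n h\<bar> \<le> r / 4" for n
    using r by (intro average_dist h(2) P(2)) auto
  obtain N where N: "\<And>n. n \<ge> N \<Longrightarrow> \<bar>average p n h - (\<integral>x. h x \<partial>M)\<bar> < r / 4"
    using LIMSEQ_D[OF average_step_fun_tendsto[OF conv h(1)], of "r / 4"] r by auto
  show "\<exists>N. \<forall>n\<ge>N. norm (average p n g - (\<integral>x. ?g x \<partial>M)) < r"
  proof (intro exI allI impI)
    fix n assume "n \<ge> N"
    then show "norm (average p n g - (\<integral>x. ?g x \<partial>M)) < r"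
      using 1 2[of n] N[of n] unfolding real_norm_def by linarith
  qed
qed

section \<open>Positivity of the limit\<close>

text \<open>On \<open>(0, R]\<close> the derivative of \<open>ln\<close> is at least
  \<open>1 / R\<close>; the factor \<open>ln 10\<close> comes from the change of base.\<close>

lemma log_diff_ge:
  fixes u v :: real
  assumes "0 < u" "0 < v" "u \<le> R" "v \<le> R"
  shows "((u - v) / (R * ln 10))\<^sup>2 \<le> (log 10 u - log 10 v)\<^sup>2"
proof -
  have *: "(a - b) / R \<le> ln a - ln b" if "0 < b" "b \<le> a" "a \<le> R" for a b
  proof -
    \<comment> \<open>The elementary bound of \<open>ln t\<close> by \<open>t - 1\<close>, taken at
      \<open>t = b / a\<close>, replaces the mean value theorem.\<close>
    have "ln (b / a) \<le> b / a - 1" using that by (intro ln_le_minus_one) auto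
    then have "(a - b) / a \<le> ln a - ln b" using that by (simp add: ln_div field_simps)
    moreover have "(a - b) / R \<le> (a - b) / a" using that by (intro divide_left_mono) auto
    ultimately show ?thesis by linarith
  qed
  have "R > 0" using assms by simp
  have "\<bar>u - v\<bar> / R \<le> \<bar>ln u - ln v\<bar>"
    using *[of v u] *[of u v] assms by (cases "v \<le> u") auto
  then have "\<bar>u - v\<bar> / R / ln 10 \<le> \<bar>ln u - ln v\<bar> / ln 10"
    by (intro divide_right_mono) auto
  then have "\<bar>(u - v) / (R * ln 10)\<bar> \<le> \<bar>log 10 u - log 10 v\<bar>"
    using \<open>R > 0\<close> by (simp add: log_def abs_mult flip: diff_divide_distrib)
  then show ?thesis by (simp only: abs_le_square_iff)
qed

text \<open>Squaring the equality of distances cancels the quadratic term in \<open>x\<close> and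
  leaves a linear equation with nonzero normal vector \<open>q - q'\<close>.\<close>

lemma on_hyperplane_equidistant:
  fixes q q' :: "real ^ 'm"
  assumes "q \<noteq> q'" "\<And>x. x \<in> S \<Longrightarrow> norm (x - q) = norm (x - q')"
  shows "on_hyperplane S"
proof -
  let ?H = "{x. (q - q') \<bullet> x = (q \<bullet> q - q' \<bullet> q') / 2}"
  have "x \<in> ?H" if "x \<in> S" for x
  proof -
    have "(x - q) \<bullet> (x - q) = (x - q') \<bullet> (x - q')"
      using assms(2)[OF that] by (simp add: norm_eq)
    then show ?thesis by (simp add: inner_diff inner_commute)
  qed
  moreover have "aff_dim ?H = int CARD('m) - 1"
    using assms(1) by (subst aff_dim_hyperplane) auto
  ultimately show ?thesis
    unfolding on_hyperplane_def using affine_hyperplane by blast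
qed

lemma rss_cost_eq_average:
  "rss_cost p p0 n q = average p n (\<lambda>x. (log 10 (norm (x - q)) - log 10 (norm (x - p0)))\<^sup>2)"
  by (simp add: rss_cost_def average_def)

lemma (in borel_prob_space) rss_cost_limit_pos:
  fixes P :: "(real ^ 'm) set"
  assumes conv: "joint_weak_conv (empirical_cdf p) (joint_cdf M)"
    and P: "compact P" "\<And>i. i \<ge> 1 \<Longrightarrow> p i \<in> P"
    and spread: "\<not> (\<exists>P'. P' \<subseteq> P \<and> measure M P' = 1 \<and> on_hyperplane P')"
    and p0: "p0 \<notin> P" and q: "q \<notin> p ` {1..}" "q \<noteq> p0"
    and lim: "(\<lambda>n. rss_cost p p0 n q) \<longlonglongrightarrow> l"
  shows "l > 0"
proof -
  have inP: "AE x in M. x \<in> P"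
    using AE_in_closed_support[OF conv compact_imp_closed[OF P(1)] P(2)] .
  obtain B where B: "\<And>x. x \<in> P \<Longrightarrow> norm x \<le> B"
    using compact_imp_bounded[OF P(1)] unfolding bounded_iff by auto
  \<comment> \<open>A bound for the distances from all points of \<open>P\<close> to
    \<open>q\<close> and to \<open>p0\<close>; the summand 1 ensures positivity.\<close>
  define R where "R = \<bar>B\<bar> + norm q + norm p0 + 1"
  have "R > 0" by (simp add: R_def add_nonneg_pos)
  have R: "norm (x - q) \<le> R" "norm (x - p0) \<le> R" if "x \<in> P" for x
    using B[OF that] norm_triangle_ineq4[of x q] norm_triangle_ineq4[of x p0]
      norm_ge_zero[of q] norm_ge_zero[of p0] unfolding R_def by linarith+
  define g where "g x = ((norm (x - q) - norm (x - p0)) / (R * ln 10))\<^sup>2" for x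
  let ?g = "\<lambda>x. indicator P x * g x"
  have cont: "continuous_on P g"
    unfolding g_def using \<open>R > 0\<close> by (intro continuous_intros) auto
  have "average p n g \<le> rss_cost p p0 n q" for n
    unfolding rss_cost_eq_average
  proof (rule average_mono)
    fix i :: nat assume "i \<ge> 1"
    \<comment> \<open>Both distances are positive, so the logarithmic bound applies and the
      convention \<open>log 10 0 = 0\<close> never enters.\<close>
    then have "p i \<in> P" "p i \<noteq> q" "p i \<noteq> p0" using P(2) p0 q(1) by auto
    then show "g (p i) \<le> (log 10 (norm (p i - q)) - log 10 (norm (p i - p0)))\<^sup>2"
      unfolding g_def using R by (intro log_diff_ge) auto
  qed
  then have "(\<integral>x. ?g x \<partial>M) \<le> l"
    using LIMSEQ_le[OF average_tendsto_integral[OF conv P cont] lim] by auto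
  moreover have "(\<integral>x. ?g x \<partial>M) > 0"
  proof (rule ccontr)
    assume "\<not> ?thesis"
    moreover have nonneg: "?g x \<ge> 0" for x by (simp add: g_def)
    ultimately have zero: "(\<integral>x. ?g x \<partial>M) = 0"
      by (simp add: integral_nonneg_AE order_antisym not_less)
    have "?g \<in> borel_measurable borel"
      using borel_measurable_continuous_on_indicator[OF borel_closed[OF compact_imp_closed[OF P(1)]] cont]
      by simp
    then have meas_g: "?g \<in> borel_measurable M"
      using sets_M by (simp cong: measurable_cong_sets)
    obtain C where C: "\<And>x. x \<in> P \<Longrightarrow> norm (g x) \<le> C"
      using compact_imp_bounded[OF compact_continuous_image[OF cont P(1)]]
      unfolding bounded_iff by auto
    have "AE x in M. norm (?g x) \<le> C"
      using inP by eventually_elim (use C in auto)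
    then have "integrable M ?g"
      using meas_g by (intro integrable_const_bound)
    then have "AE x in M. ?g x = 0"
      using zero nonneg by (simp add: integral_nonneg_eq_0_iff_AE)
    \<comment> \<open>A zero integral of the nonnegative \<open>?g\<close> forces equal distances
      almost surely, so a subset of \<open>P\<close> of full measure lies on the bisector of
      \<open>q\<close> and \<open>p0\<close>, against \<open>spread\<close>.\<close>
    then have AE: "AE x in M. x \<in> {x \<in> P. norm (x - q) = norm (x - p0)}"
      using inP by eventually_elim (use \<open>R > 0\<close> in \<open>auto simp: g_def\<close>)
    have "{x \<in> P. norm (x - q) = norm (x - p0)} = P \<inter> {x. norm (x - q) = norm (x - p0)}"
      by auto
    also have "closed \<dots>"
      by (intro closed_Int compact_imp_closed[OF P(1)] closed_Collect_eq continuous_intros)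
    finally have "{x \<in> P. norm (x - q) = norm (x - p0)} \<in> sets M"
      by (simp add: sets_M borel_closed)
    then have "measure M {x \<in> P. norm (x - q) = norm (x - p0)} = 1"
      using AE by (rule prob_eq_1[THEN iffD2])
    moreover have "on_hyperplane {x \<in> P. norm (x - q) = norm (x - p0)}"
      using q(2) by (rule on_hyperplane_equidistant) simp
    moreover have "{x \<in> P. norm (x - q) = norm (x - p0)} \<subseteq> P" by auto
    ultimately show False using spread by metis
  qed
  ultimately show ?thesis by linarith
qed

section \<open>Existence of the limit and uniqueness of its minimum\<close>

theorem theorem1:
  fixes p0 :: "real ^ 'm"
    and p :: "nat \<Rightarrow> real ^ 'm"
    and P0 P :: "(real ^ 'm) set"
    and \<mu> :: "(real ^ 'm) measure"
  assumes dim: "CARD('m) \<in> {2, 3}"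
    and source: "bounded P0" "p0 \<in> P0"
    and sensors: "bounded P" "closed P" "\<And>i. i \<ge> 1 \<Longrightarrow> p i \<in> P"
    and disjoint: "P0 \<inter> P = {}"
    and mu: "prob_space \<mu>" "sets \<mu> = sets borel"
    and conv: "joint_weak_conv (empirical_cdf p) (joint_cdf \<mu>)"
    and sensors_spread: "\<And>n. n \<ge> CARD('m) + 1 \<Longrightarrow> \<not> on_hyperplane (p ` {1..n})"
    and mu_spread: "\<not> (\<exists>P'. P' \<subseteq> P \<and> measure \<mu> P' = 1 \<and> on_hyperplane P')"
  shows "asymptotically_localizable (- P) p p0"
proof -
  interpret borel_prob_space \<mu>
    using mu by (intro borel_prob_space.intro borel_prob_space_axioms.intro)
  have P: "compact P" using sensors(1,2) by (simp add: compact_eq_bounded_closed)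
  have p0: "p0 \<notin> P" using source(2) disjoint by auto
  have sub: "- P \<subseteq> limit_domain p p0"
  proof
    fix q assume q: "q \<in> - P"
    \<comment> \<open>Neither \<open>q\<close> nor \<open>p0\<close> lies in \<open>P\<close>, so
      both logarithms have nonzero arguments throughout \<open>P\<close>.\<close>
    have "continuous_on P (\<lambda>x. (log 10 (norm (x - q)) - log 10 (norm (x - p0)))\<^sup>2)"
      using p0 q unfolding log_def by (intro continuous_intros) auto
    from average_tendsto_integral[OF conv P sensors(3) this]
    have "convergent (\<lambda>n. rss_cost p p0 n q)"
      unfolding rss_cost_eq_average by (rule convergentI)
    then show "q \<in> limit_domain p p0"
      using q sensors(3) by (auto simp: limit_domain_def)
  qed
  have at_p0: "limit_cost p p0 p0 = 0"
    by (simp add: limit_cost_def rss_cost_def)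
  \<comment> \<open>The point \<open>q\<close> ranges over all of \<open>limit_domain\<close>,
    including points of \<open>P\<close> that are not sensors, so positivity comes from the lower
    bound and not from an integral formula for the limit.\<close>
  have pos: "limit_cost p p0 q > 0" if "q \<in> limit_domain p p0" "q \<noteq> p0" for q
    using that rss_cost_limit_pos[OF conv P sensors(3) mu_spread p0]
    by (auto simp: limit_domain_def limit_cost_def convergent_LIMSEQ_iff)
  have "p0 \<in> limit_domain p p0" using sub p0 by auto
  then have "is_arg_min (limit_cost p p0) (\<lambda>x. x \<in> limit_domain p p0) q \<longleftrightarrow> q = p0" for q
    using pos at_p0 unfolding is_arg_min_def by (metis less_asym less_irrefl)
  then show ?thesis using sub by (simp add: asymptotically_localizable_def)
qed

end
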